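(* Let $N,d,m$ be positive integers, $A_1,\dots,A_N\in\mathcal M_d(\mathbb C)$, $B\in\mathcal M_{d,m}(\mathbb C)$, $T\in(0,+\infty)$, and assume that $(\Lambda_1,\dots,\Lambda_N)=\lambda(k_1,\dots,k_N)$ with $\lambda>0$ and $k_1,\dots,k_N$ positive integers. Let $K=\max_j k_j$ and $M=\lfloor T/\lambda\rfloor$. Let $\widehat A\in\mathcal M_{Kd}(\mathbb C)$, $\widehat B\in\mathcal M_{Kd,m}(\mathbb C)$ and $C\in\mathcal M_{Kd,Mm}(\mathbb C)$ be the matrices defined in the context. Then $$C=\begin{pmatrix}\widehat B & \widehat A\widehat B & \widehat A^2\widehat B & \cdots & \widehat A^{M-1}\widehat B\end{pmatrix}.$$
   Context: Let $\mathbb N$ be the set of nonnegative integers and $e_1,\dots,e_N$ the canonical basis of $\mathbb Z^N$. The matrices $\Xi_{\mathbf n}\in\mathcal M_d(\mathbb C)$, $\mathbf n\in\mathbb Z^N$, are defined inductively by $\Xi_{\mathbf n}=0$ if $\mathbf n\in\mathbb Z^N\setminus\mathbb N^N$, $\Xi_0=\mathrm{Id}_d$, and $\Xi_{\mathbf n}=\sum_{k=1}^N A_k\Xi_{\mathbf n-e_k}$ if $\mathbf n\in\mathbb N^N\setminus\{0\}$. With $k=(k_1,\dots,k_N)$, $C=(C_{j\ell})_{1\le j\le K,\,1\le\ell\le M}$ is the block matrix with $d\times m$ blocks $$C_{j\ell}=\sum_{\mathbf n\in\mathbb N^N,\ k\cdot\mathbf n=\ell-j}\Xi_{\mathbf n}B$$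 (an empty sum is zero). The augmented matrices are $$\widehat A=\begin{pmatrix}\widehat A_1&\widehat A_2&\widehat A_3&\cdots&\widehat A_K\\ \mathrm{Id}_d&0&0&\cdots&0\\ 0&\mathrm{Id}_d&0&\cdots&0\\ \vdots&\vdots&\ddots&\ddots&\vdots\\ 0&0&\cdots&\mathrm{Id}_d&0\end{pmatrix},\qquad \widehat B=\begin{pmatrix}B\\0\\ \vdots\\0\end{pmatrix},\qquad \widehat A_r=\sum_{j:\,k_j=r}A_j\quad(1\le r\le K),$$ with $\widehat A_r=0$ if no $k_j$ equals $r$. *)

theory Defs
  imports "Jordan_Normal_Form.Matrix" Complex_Main
begin

text \<open>
  The families \<open>A_1, ..., A_N\<close>, \<open>k_1, ..., k_N\<close> and \<open>\<Lambda>_1, ..., \<Lambda>_N\<close> are functions on \<open>nat\<close>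
  indexed by \<open>0, ..., N - 1\<close>, in accordance with the \<open>0\<close>-based coordinates of \<open>'a vec\<close>; their
  values at other indices are irrelevant.  Multi-indices in \<open>\<int>^N\<close> are elements of
  \<open>carrier_vec N\<close> over \<open>int\<close>.  Blocks of block matrices are numbered from \<open>1\<close>.
\<close>

definition mat_sum :: "nat \<Rightarrow> nat \<Rightarrow> ('i \<Rightarrow> complex mat) \<Rightarrow> 'i set \<Rightarrow> complex mat" where
  "mat_sum nr nc F I = mat nr nc (\<lambda>ij. \<Sum>i\<in>I. F i $$ ij)"

lemma mat_sum_cong [fundef_cong]:
  assumes "nr = nr'" "nc = nc'" "I = I'" "\<And>i. i \<in> I' \<Longrightarrow> F i = F' i"
  shows "mat_sum nr nc F I = mat_sum nr' nc' F' I'"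
  using assms by (simp add: mat_sum_def)

lemma mat_sum_carrier [simp]: "mat_sum nr nc F I \<in> carrier_mat nr nc"
  by (simp add: mat_sum_def)

lemma mat_sum_empty [simp]: "mat_sum nr nc F {} = 0\<^sub>m nr nc"
  by (rule eq_matI) (auto simp: mat_sum_def)

lemma mat_sum_insert:
  assumes "finite I" "i \<notin> I" "F i \<in> carrier_mat nr nc"
  shows "mat_sum nr nc F (insert i I) = F i + mat_sum nr nc F I"
  using assms by (intro eq_matI) (auto simp: mat_sum_def)

text \<open>The \<open>p * q\<close> block matrix with \<open>r * c\<close> blocks \<open>F i j\<close>, \<open>1 \<le> i \<le> p\<close>, \<open>1 \<le> j \<le> q\<close>.\<close>

definition block_mat :: "nat \<Rightarrow> nat \<Rightarrow> nat \<Rightarrow> nat \<Rightarrow> (nat \<Rightarrow> nat \<Rightarrow> complex mat) \<Rightarrow> complex mat" where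
  "block_mat p q r c F =
     mat (p * r) (q * c) (\<lambda>(i, j). F (i div r + 1) (j div c + 1) $$ (i mod r, j mod c))"

definition multi_nats :: "nat \<Rightarrow> int vec set" where
  "multi_nats N = {n \<in> carrier_vec N. \<forall>i<N. 0 \<le> n $ i}"

text \<open>Outside \<open>carrier_vec N\<close>, that is outside \<open>\<int>^N\<close>, \<open>Xi\<close> is the zero matrix by convention.\<close>

function Xi :: "nat \<Rightarrow> nat \<Rightarrow> (nat \<Rightarrow> complex mat) \<Rightarrow> int vec \<Rightarrow> complex mat" where
  "Xi N d A n =
     (if n \<notin> multi_nats N then 0\<^sub>m d d
      else if n = 0\<^sub>v N then 1\<^sub>m d
      else mat_sum d d (\<lambda>k. A k * Xi N d A (n - unit_vec N k)) {..<N})"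
  by pat_completeness auto
termination
proof (relation "measure (\<lambda>(N, d, A, n). nat (\<Sum>i<N. n $ i))", goal_cases)
  case 1
  show ?case by simp
next
  case (2 N d A n k)
  from 2 have n: "dim_vec n = N" "\<And>i. i < N \<Longrightarrow> 0 \<le> n $ i" and k: "k < N"
    by (auto simp: multi_nats_def)
  have "\<exists>i<N. n $ i \<noteq> 0"
  proof (rule ccontr)
    assume "\<not> (\<exists>i<N. n $ i \<noteq> 0)"
    with n(1) have "n = 0\<^sub>v N" by (intro eq_vecI) auto
    with 2(2) show False by simp
  qed
  then obtain i where i: "i < N" "n $ i \<noteq> 0" by blast
  have "0 < (\<Sum>i<N. n $ i)"
    using n(2) i by (intro sum_pos2[of _ i]) (auto simp: less_le)
  moreover have "(\<Sum>i<N. (n - unit_vec N k) $ i) = (\<Sum>i<N. n $ i - (if i = k then 1 else 0))"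
    using k by (intro sum.cong) auto
  moreover have "\<dots> = (\<Sum>i<N. n $ i) - 1"
    using k by (simp add: sum_subtractf)
  ultimately show ?case by simp
qed

declare Xi.simps [simp del]

definition weight :: "nat \<Rightarrow> (nat \<Rightarrow> nat) \<Rightarrow> int vec \<Rightarrow> int" where
  "weight N k n = (\<Sum>i<N. int (k i) * n $ i)"

lemma finite_weight_eq:
  assumes "\<And>i. i < N \<Longrightarrow> 0 < k i"
  shows "finite {n \<in> multi_nats N. weight N k n = s}"
proof (rule finite_subset)
  let ?L = "{xs. set xs \<subseteq> {0..s} \<and> length xs = N}"
  show "finite (vec_of_list ` ?L)"
    by (intro finite_imageI finite_lists_length_eq) simp
  show "{n \<in> multi_nats N. weight N k n = s} \<subseteq> vec_of_list ` ?L"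
  proof
    fix n assume "n \<in> {n \<in> multi_nats N. weight N k n = s}"
    then have n: "dim_vec n = N" "\<And>i. i < N \<Longrightarrow> 0 \<le> n $ i" and s: "weight N k n = s"
      by (auto simp: multi_nats_def)
    have "n $ i \<le> s" if i: "i < N" for i
    proof -
      have "1 * n $ i \<le> int (k i) * n $ i"
        using assms[OF i] n(2)[OF i] by (intro mult_right_mono) auto
      also have "\<dots> \<le> weight N k n"
        unfolding weight_def using i n(2) by (intro member_le_sum) auto
      finally show ?thesis using s by simp
    qed
    with n have "list_of_vec n \<in> ?L"
      by (auto simp: set_list_of_vec vec_set_def)
    then show "n \<in> vec_of_list ` ?L"
      by (intro image_eqI[of _ _ "list_of_vec n"]) (simp_all add: vec_list)
  qed
qed

text \<open>
  The difference \<open>l - j\<close> is taken in the integers, so that the sum is empty for \<open>l < j\<close>.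
\<close>

definition C_block :: "nat \<Rightarrow> nat \<Rightarrow> nat \<Rightarrow> (nat \<Rightarrow> complex mat) \<Rightarrow> complex mat \<Rightarrow> (nat \<Rightarrow> nat) \<Rightarrow>
    nat \<Rightarrow> nat \<Rightarrow> complex mat" where
  "C_block N d m A B k j l =
     mat_sum d m (\<lambda>n. Xi N d A n * B) {n \<in> multi_nats N. weight N k n = int l - int j}"

definition C_mat :: "nat \<Rightarrow> nat \<Rightarrow> nat \<Rightarrow> (nat \<Rightarrow> complex mat) \<Rightarrow> complex mat \<Rightarrow> (nat \<Rightarrow> nat) \<Rightarrow>
    nat \<Rightarrow> nat \<Rightarrow> complex mat" where
  "C_mat N d m A B k K M = block_mat K M d m (C_block N d m A B k)"

definition A_hat_block :: "nat \<Rightarrow> nat \<Rightarrow> (nat \<Rightarrow> complex mat) \<Rightarrow> (nat \<Rightarrow> nat) \<Rightarrow> nat \<Rightarrow> complex mat" where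
  "A_hat_block N d A k r = mat_sum d d A {j. j < N \<and> k j = r}"

definition A_hat :: "nat \<Rightarrow> nat \<Rightarrow> (nat \<Rightarrow> complex mat) \<Rightarrow> (nat \<Rightarrow> nat) \<Rightarrow> nat \<Rightarrow> complex mat" where
  "A_hat N d A k K = block_mat K K d d
     (\<lambda>i j. if i = 1 then A_hat_block N d A k j
            else if i = j + 1 then 1\<^sub>m d else 0\<^sub>m d d)"

definition B_hat :: "nat \<Rightarrow> nat \<Rightarrow> complex mat \<Rightarrow> nat \<Rightarrow> complex mat" where
  "B_hat d m B K = block_mat K 1 d m (\<lambda>i j. if i = 1 then B else 0\<^sub>m d m)"

end

theory Submission
  imports Defs
begin

text \<open>
  The matrices \<open>S\<^sub>s\<close>, the sum of \<open>Xi\<^sub>n\<close> over all \<open>n\<close> of weight \<open>s\<close>, satisfy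
  \<open>S\<^sub>s = \<Sum>\<^sub>r A_hat_block\<^sub>r S\<^bsub>s-r\<^esub>\<close> for \<open>s > 0\<close>, and \<open>C\<^sub>j\<^sub>l = S\<^bsub>l-j\<^esub> B\<close>.  Since \<open>A_hat\<close> is the companion matrix
  of this recurrence, it maps the \<open>l\<close>-th block column of \<open>C\<close> to the next one.
\<close>

section \<open>Algebra of finite matrix sums\<close>

lemma mat_sum_dim [simp]:
  "dim_row (mat_sum nr nc F I) = nr" "dim_col (mat_sum nr nc F I) = nc"
  by (simp_all add: mat_sum_def)

lemma mat_sum_mult_right:
  assumes "\<And>i. i \<in> I \<Longrightarrow> F i \<in> carrier_mat nr n" "B \<in> carrier_mat n nc"
  shows "mat_sum nr n F I * B = mat_sum nr nc (\<lambda>i. F i * B) I"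
proof (rule eq_matI)
  fix a b assume "a < dim_row (mat_sum nr nc (\<lambda>i. F i * B) I)"
    "b < dim_col (mat_sum nr nc (\<lambda>i. F i * B) I)"
  then have ab: "a < nr" "b < nc" by simp_all
  have "(F i * B) $$ (a, b) = (\<Sum>u<n. F i $$ (a, u) * B $$ (u, b))" if "i \<in> I" for i
    using assms(1)[OF that] assms(2) ab by (auto simp: scalar_prod_def lessThan_atLeast0)
  with assms ab show "(mat_sum nr n F I * B) $$ (a, b) = mat_sum nr nc (\<lambda>i. F i * B) I $$ (a, b)"
    by (auto simp: mat_sum_def scalar_prod_def lessThan_atLeast0 sum_distrib_right
        intro: sum.swap)
qed (use assms in auto)

lemma mat_sum_mult_left:
  assumes "\<And>i. i \<in> I \<Longrightarrow> F i \<in> carrier_mat n nc" "A \<in> carrier_mat nr n"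
  shows "A * mat_sum n nc F I = mat_sum nr nc (\<lambda>i. A * F i) I"
proof (rule eq_matI)
  fix a b assume "a < dim_row (mat_sum nr nc (\<lambda>i. A * F i) I)"
    "b < dim_col (mat_sum nr nc (\<lambda>i. A * F i) I)"
  then have ab: "a < nr" "b < nc" by simp_all
  have "(A * F i) $$ (a, b) = (\<Sum>u<n. A $$ (a, u) * F i $$ (u, b))" if "i \<in> I" for i
    using assms(1)[OF that] assms(2) ab by (auto simp: scalar_prod_def lessThan_atLeast0)
  with assms ab show "(A * mat_sum n nc F I) $$ (a, b) = mat_sum nr nc (\<lambda>i. A * F i) I $$ (a, b)"
    by (auto simp: mat_sum_def scalar_prod_def lessThan_atLeast0 sum_distrib_left
        intro: sum.swap)
qed (use assms in auto)

lemma mat_sum_swap: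
  "mat_sum nr nc (\<lambda>i. mat_sum nr nc (F i) J) I = mat_sum nr nc (\<lambda>j. mat_sum nr nc (\<lambda>i. F i j) I) J"
  by (rule eq_matI) (auto simp: mat_sum_def intro: sum.swap)

lemma mat_sum_group:
  assumes "finite I" "finite R" "g ` I \<subseteq> R"
  shows "mat_sum nr nc (\<lambda>r. mat_sum nr nc F {i \<in> I. g i = r}) R = mat_sum nr nc F I"
  using assms by (intro eq_matI) (auto simp: mat_sum_def sum.group)

text \<open>Serves the lower block rows of \<open>A_hat\<close>, where a single identity block picks
  one term out of the sum.\<close>

lemma mat_sum_delta:
  assumes "finite I" "i \<in> I" "F i \<in> carrier_mat nr nc"
  shows "mat_sum nr nc (\<lambda>j. if j = i then F j else 0\<^sub>m nr nc) I = F i"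
proof (rule eq_matI)
  fix a b assume "a < dim_row (F i)" "b < dim_col (F i)"
  with assms have ab: "a < nr" "b < nc" by auto
  then have "(if j = i then F j else 0\<^sub>m nr nc) $$ (a, b) = (if j = i then F j $$ (a, b) else 0)" for j
    by simp
  with assms ab show "mat_sum nr nc (\<lambda>j. if j = i then F j else 0\<^sub>m nr nc) I $$ (a, b) = F i $$ (a, b)"
    by (simp add: mat_sum_def)
qed (use assms in auto)

section \<open>Block matrices and their products\<close>

lemma block_mat_carrier [simp]: "block_mat p q r c F \<in> carrier_mat (p * r) (q * c)"
  by (simp add: block_mat_def)

lemma block_mat_cong:
  assumes "\<And>i j. 1 \<le> i \<Longrightarrow> i \<le> p \<Longrightarrow> 1 \<le> j \<Longrightarrow> j \<le> q \<Longrightarrow> F i j = G i j"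
  shows "block_mat p q r c F = block_mat p q r c G"
proof -
  have "F (i div r + 1) (j div c + 1) = G (i div r + 1) (j div c + 1)"
    if "i < p * r" "j < q * c" for i j
    using less_mult_imp_div_less[OF that(1)] less_mult_imp_div_less[OF that(2)]
    by (intro assms) auto
  then show ?thesis
    by (intro eq_matI) (auto simp: block_mat_def)
qed

text \<open>The inner index of the scalar product is written as \<open>h * c + u\<close> with
  \<open>u < c\<close>. The sum over \<open>u\<close> is then an entry of a product of blocks, and
  the sum over \<open>h\<close> adds these products up.\<close>

lemma block_mat_mult:
  assumes F: "\<And>i h. 1 \<le> i \<Longrightarrow> i \<le> p \<Longrightarrow> 1 \<le> h \<Longrightarrow> h \<le> q \<Longrightarrow> F i h \<in> carrier_mat r c"
    and G: "\<And>h j. 1 \<le> h \<Longrightarrow> h \<le> q \<Longrightarrow> 1 \<le> j \<Longrightarrow> j \<le> s \<Longrightarrow> G h j \<in> carrier_mat c t"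
  shows "block_mat p q r c F * block_mat q s c t G =
    block_mat p s r t (\<lambda>i j. mat_sum r t (\<lambda>h. F i h * G h j) {1..q})"
proof (rule eq_matI)
  let ?R = "block_mat p s r t (\<lambda>i j. mat_sum r t (\<lambda>h. F i h * G h j) {1..q})"
  fix a b assume "a < dim_row ?R" "b < dim_col ?R"
  then have ab: "a < p * r" "b < s * t" by (simp_all add: block_mat_def)
  define i j where "i = a div r + 1" and "j = b div t + 1"
  \<comment> \<open>The mere existence of an entry forces nonempty blocks, so \<open>a mod r\<close>
    and \<open>b mod t\<close> are valid positions in a block.\<close>
  have pos: "0 < r" "0 < t" using ab by (auto intro: gr0I)
  have ij: "1 \<le> i" "i \<le> p" "1 \<le> j" "j \<le> s"
    using less_mult_imp_div_less[OF ab(1)] less_mult_imp_div_less[OF ab(2)]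
    by (simp_all add: i_def j_def)
  let ?f = "\<lambda>u. F i (u div c + 1) $$ (a mod r, u mod c) * G (u div c + 1) j $$ (u mod c, b mod t)"
  have "(block_mat p q r c F * block_mat q s c t G) $$ (a, b) = (\<Sum>u<q * c. ?f u)"
    using ab by (simp add: block_mat_def scalar_prod_def lessThan_atLeast0 i_def j_def)
  also have "\<dots> = (\<Sum>h<q. \<Sum>u = h * c..<h * c + c. ?f u)"
    by (simp add: sum.nat_group)
  also have "\<dots> = (\<Sum>h<q. \<Sum>u<c. F i (h + 1) $$ (a mod r, u) * G (h + 1) j $$ (u, b mod t))"
  proof (rule sum.cong [OF refl])
    fix h
    have "(\<Sum>u = h * c..<h * c + c. ?f u) = (\<Sum>u = 0..<c. ?f (u + h * c))"
      using sum.shift_bounds_nat_ivl[of ?f 0 "h * c" c] by (simp add: add.commute)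
    then show "(\<Sum>u = h * c..<h * c + c. ?f u) =
        (\<Sum>u<c. F i (h + 1) $$ (a mod r, u) * G (h + 1) j $$ (u, b mod t))"
      by (simp add: lessThan_atLeast0)
  qed
  also have "\<dots> = (\<Sum>h<q. (F i (h + 1) * G (h + 1) j) $$ (a mod r, b mod t))"
  proof (rule sum.cong [OF refl])
    fix h assume "h \<in> {..<q}"
    then have "F i (h + 1) \<in> carrier_mat r c" "G (h + 1) j \<in> carrier_mat c t"
      using ij by (auto intro!: F G)
    then show "(\<Sum>u<c. F i (h + 1) $$ (a mod r, u) * G (h + 1) j $$ (u, b mod t)) =
        (F i (h + 1) * G (h + 1) j) $$ (a mod r, b mod t)"
      using pos by (auto simp: scalar_prod_def lessThan_atLeast0)
  qed
  \<comment> \<open>Passes from positions counted from 0 to blocks numbered from 1.\<close>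
  also have "\<dots> = (\<Sum>h = 1..q. (F i h * G h j) $$ (a mod r, b mod t))"
    by (rule sum.reindex_bij_witness[of _ "\<lambda>h. h - 1" Suc]) auto
  also have "\<dots> = ?R $$ (a, b)"
    using ab pos by (simp add: block_mat_def mat_sum_def i_def j_def)
  finally show "(block_mat p q r c F * block_mat q s c t G) $$ (a, b) = ?R $$ (a, b)" .
qed (simp_all add: block_mat_def)

section \<open>Sums of \<open>Xi\<close> over multi-indices of fixed weight\<close>

lemma Xi_carrier [simp]: "Xi N d A n \<in> carrier_mat d d"
  by (subst Xi.simps) simp

text \<open>The weight \<open>s\<close> is an integer because it will be \<open>l - j\<close>, which
  is negative below the block diagonal.\<close>

definition Xi_sum :: "nat \<Rightarrow> nat \<Rightarrow> (nat \<Rightarrow> complex mat) \<Rightarrow> (nat \<Rightarrow> nat) \<Rightarrow> int \<Rightarrow> complex mat" where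
  "Xi_sum N d A k s = mat_sum d d (Xi N d A) {n \<in> multi_nats N. weight N k n = s}"

lemma Xi_sum_carrier [simp]: "Xi_sum N d A k s \<in> carrier_mat d d"
  by (simp add: Xi_sum_def)

lemma C_block_eq_Xi_sum:
  assumes "B \<in> carrier_mat d m"
  shows "C_block N d m A B k j l = Xi_sum N d A k (int l - int j) * B"
  using assms by (simp add: C_block_def Xi_sum_def mat_sum_mult_right)

lemma weight_nonneg: "n \<in> multi_nats N \<Longrightarrow> 0 \<le> weight N k n"
  by (auto simp: weight_def multi_nats_def intro!: sum_nonneg)

lemma weight_minus_unit_vec:
  assumes "n \<in> carrier_vec N" "i < N"
  shows "weight N k (n - unit_vec N i) = weight N k n - int (k i)"
proof -
  have "weight N k (n - unit_vec N i) = (\<Sum>j<N. int (k j) * n $ j - (if j = i then int (k j) else 0))"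
    unfolding weight_def using assms by (intro sum.cong) (auto simp: algebra_simps)
  with assms show ?thesis by (simp add: weight_def sum_subtractf)
qed

text \<open>A sum of nonnegative terms vanishes only termwise, and each \<open>k i\<close> is
  positive. This separates the base case of \<open>Xi\<close> from its recursive case according to
  the weight.\<close>

lemma weight_eq_0_iff:
  assumes "\<And>i. i < N \<Longrightarrow> 0 < k i" "n \<in> multi_nats N"
  shows "weight N k n = 0 \<longleftrightarrow> n = 0\<^sub>v N"
proof
  assume "weight N k n = 0"
  with assms(2) have "\<forall>i\<in>{..<N}. int (k i) * n $ i = 0"
    by (subst (asm) weight_def, subst (asm) sum_nonneg_eq_0_iff) (auto simp: multi_nats_def)
  then have "int (k i) * n $ i = 0" if "i < N" for i
    using that by simp
  then have "n $ i = 0" if "i < N" for i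
    using assms(1)[OF that] that by fastforce
  with assms(2) show "n = 0\<^sub>v N"
    by (intro eq_vecI) (auto simp: multi_nats_def)
qed (simp add: weight_def)

lemma Xi_sum_neg: "s < 0 \<Longrightarrow> Xi_sum N d A k s = 0\<^sub>m d d"
proof -
  assume "s < 0"
  then have "{n \<in> multi_nats N. weight N k n = s} = {}"
    by (auto dest: weight_nonneg[of _ _ k])
  then show ?thesis by (simp only: Xi_sum_def mat_sum_empty)
qed

lemma Xi_sum_0:
  assumes "\<And>i. i < N \<Longrightarrow> 0 < k i"
  shows "Xi_sum N d A k 0 = 1\<^sub>m d"
proof -
  have z: "0\<^sub>v N \<in> multi_nats N" by (simp add: multi_nats_def)
  then have "{n \<in> multi_nats N. weight N k n = 0} = {0\<^sub>v N}"
    using weight_eq_0_iff[of N k] assms by blast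
  moreover have "Xi N d A (0\<^sub>v N) = 1\<^sub>m d"
    using z by (subst Xi.simps) simp
  ultimately show ?thesis
    by (auto simp: Xi_sum_def mat_sum_def)
qed

text \<open>Translation by the unit vector lowers the weight by \<open>k i\<close>. Multi-indices
  that it moves out of \<open>multi_nats N\<close> contribute nothing, since \<open>Xi\<close>
  vanishes there, and on the others it is a bijection.\<close>

lemma Xi_sum_shift:
  assumes "\<And>i. i < N \<Longrightarrow> 0 < k i" "i < N"
  shows "mat_sum d d (\<lambda>n. Xi N d A (n - unit_vec N i)) {n \<in> multi_nats N. weight N k n = s} =
    Xi_sum N d A k (s - int (k i))"
proof -
  let ?W = "\<lambda>s. {n \<in> multi_nats N. weight N k n = s}" and ?e = "unit_vec N i :: int vec"
  have "(\<Sum>n\<in>?W s. Xi N d A (n - ?e) $$ ab) = (\<Sum>n\<in>?W (s - int (k i)). Xi N d A n $$ ab)"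
    if ab: "ab \<in> {..<d} \<times> {..<d}" for ab
  \<comment> \<open>\<open>S'\<close> collects the indices with zero terms on the left.
    \<open>T'\<close> is empty because adding the unit vector never leaves
    \<open>multi_nats N\<close>.\<close>
  proof (rule sum.reindex_bij_witness_not_neutral
      [where S' = "{n \<in> ?W s. n - ?e \<notin> multi_nats N}" and T' = "{}"
         and i = "\<lambda>n. n + ?e" and j = "\<lambda>n. n - ?e"])
    show "finite {n \<in> ?W s. n - ?e \<notin> multi_nats N}"
      using finite_weight_eq[of N k s, OF assms(1)] by (rule rev_finite_subset) auto
  next
    fix n assume "n \<in> {n \<in> ?W s. n - ?e \<notin> multi_nats N}"
    then have "Xi N d A (n - ?e) = 0\<^sub>m d d"
      by (subst Xi.simps) simp
    with ab show "Xi N d A (n - ?e) $$ ab = 0" by auto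
  next
    fix n assume n: "n \<in> ?W (s - int (k i)) - {}"
    then have c: "n \<in> carrier_vec N" by (simp add: multi_nats_def)
    then have e: "n + ?e - ?e = n" by (intro eq_vecI) auto
    then show "n + ?e - ?e = n" .
    have "n + ?e \<in> multi_nats N" using n assms(2) by (auto simp: multi_nats_def)
    moreover have "weight N k (n + ?e) = s"
      \<comment> \<open>The weight formula for a difference, applied at \<open>n + ?e\<close>,
        yields the one for the sum.\<close>
      using weight_minus_unit_vec[of "n + ?e" N i k] c e n assms(2) by simp
    ultimately show "n + ?e \<in> ?W s - {n \<in> ?W s. n - ?e \<notin> multi_nats N}"
      using n e by simp
  next
    fix n assume n: "n \<in> ?W s - {n \<in> ?W s. n - ?e \<notin> multi_nats N}"
    then have c: "n \<in> carrier_vec N" by (simp add: multi_nats_def)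
    then show "n - ?e + ?e = n" by (intro eq_vecI) auto
    show "n - ?e \<in> ?W (s - int (k i)) - {}"
      using n weight_minus_unit_vec[OF c assms(2)] by auto
  qed auto
  then show ?thesis
    by (intro eq_matI) (auto simp: Xi_sum_def mat_sum_def)
qed

text \<open>Every \<open>Xi\<close> in the sum is unfolded once, the two sums are exchanged, the
  shift is applied for each \<open>i\<close>, and the indices \<open>i\<close> are grouped by the
  value \<open>r\<close> of \<open>k i\<close>.\<close>

lemma Xi_sum_recurrence:
  assumes A: "\<And>i. i < N \<Longrightarrow> A i \<in> carrier_mat d d"
    and k: "\<And>i. i < N \<Longrightarrow> 0 < k i" and K: "\<And>i. i < N \<Longrightarrow> k i \<le> K" and s: "0 < s"
  shows "Xi_sum N d A k s =
    mat_sum d d (\<lambda>r. A_hat_block N d A k r * Xi_sum N d A k (s - int r)) {1..K}"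
proof -
  let ?W = "{n \<in> multi_nats N. weight N k n = s}"
  have "Xi_sum N d A k s =
      mat_sum d d (\<lambda>n. mat_sum d d (\<lambda>i. A i * Xi N d A (n - unit_vec N i)) {..<N}) ?W"
    unfolding Xi_sum_def
  proof (rule mat_sum_cong)
    fix n assume n: "n \<in> ?W"
    \<comment> \<open>Positive weight excludes the zero index, so the recursive clause of
      \<open>Xi\<close> applies.\<close>
    with s weight_eq_0_iff[where N = N and k = k and n = n, OF k] have "n \<noteq> 0\<^sub>v N" by auto
    with n show "Xi N d A n = mat_sum d d (\<lambda>i. A i * Xi N d A (n - unit_vec N i)) {..<N}"
      by (subst Xi.simps) simp
  qed simp_all
  also have "\<dots> = mat_sum d d (\<lambda>i. mat_sum d d (\<lambda>n. A i * Xi N d A (n - unit_vec N i)) ?W) {..<N}"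
    by (rule mat_sum_swap)
  also have "\<dots> = mat_sum d d (\<lambda>i. A i * Xi_sum N d A k (s - int (k i))) {..<N}"
  proof (intro mat_sum_cong refl)
    fix i assume "i \<in> {..<N}"
    then show "mat_sum d d (\<lambda>n. A i * Xi N d A (n - unit_vec N i)) ?W =
        A i * Xi_sum N d A k (s - int (k i))"
      using A Xi_sum_shift[where N = N and d = d and A = A, OF k]
      by (subst mat_sum_mult_left[symmetric]) auto
  qed
  \<comment> \<open>All \<open>k i\<close> lie in \<open>{1..K}\<close>; a value \<open>r\<close>
    that is not attained gives an empty inner sum, in accordance with a zero
    \<open>A_hat_block\<close>.\<close>
  also have "\<dots> = mat_sum d d (\<lambda>r. mat_sum d d (\<lambda>i. A i * Xi_sum N d A k (s - int (k i)))
      {i \<in> {..<N}. k i = r}) {1..K}"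
    using k K by (intro mat_sum_group[symmetric]) (auto simp: Suc_le_eq)
  also have "\<dots> = mat_sum d d (\<lambda>r. A_hat_block N d A k r * Xi_sum N d A k (s - int r)) {1..K}"
  proof (intro mat_sum_cong refl)
    fix r
    have "A_hat_block N d A k r * Xi_sum N d A k (s - int r) =
        mat_sum d d (\<lambda>i. A i * Xi_sum N d A k (s - int r)) {i. i < N \<and> k i = r}"
      unfolding A_hat_block_def using A by (intro mat_sum_mult_right) auto
    also have "\<dots> = mat_sum d d (\<lambda>i. A i * Xi_sum N d A k (s - int (k i))) {i \<in> {..<N}. k i = r}"
      by (intro mat_sum_cong) auto
    finally show "mat_sum d d (\<lambda>i. A i * Xi_sum N d A k (s - int (k i))) {i \<in> {..<N}. k i = r} =
        A_hat_block N d A k r * Xi_sum N d A k (s - int r)" by simp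
  qed
  finally show ?thesis .
qed

section \<open>Block columns of \<open>C\<close> and powers of \<open>A_hat\<close>\<close>

text \<open>The first block row of \<open>A_hat\<close> reproduces the recurrence for
  \<open>Xi_sum\<close>. The other rows move each block down by one, which is right because
  \<open>C_block\<close> depends on \<open>j\<close> and \<open>l\<close> only through
  \<open>l - j\<close>.\<close>

lemma A_hat_mult_C_column:
  assumes A: "\<And>i. i < N \<Longrightarrow> A i \<in> carrier_mat d d" and B: "B \<in> carrier_mat d m"
    and k: "\<And>i. i < N \<Longrightarrow> 0 < k i" and K: "\<And>i. i < N \<Longrightarrow> k i \<le> K" and l: "0 < l"
  shows "A_hat N d A k K * block_mat K 1 d m (\<lambda>i _. C_block N d m A B k i l) =
    block_mat K 1 d m (\<lambda>i _. C_block N d m A B k i (Suc l))"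
proof -
  let ?H = "A_hat_block N d A k" and ?C = "\<lambda>i l. C_block N d m A B k i l"
  let ?F = "\<lambda>i j. if i = 1 then ?H j else if i = j + 1 then 1\<^sub>m d else 0\<^sub>m d d"
  have C: "?C i l \<in> carrier_mat d m" for i l
    by (simp add: C_block_def)
  have H: "?H j \<in> carrier_mat d d" for j
    by (simp add: A_hat_block_def)
  have "mat_sum d m (\<lambda>h. ?F i h * ?C h l) {1..K} = ?C i (Suc l)" if i: "1 \<le> i" "i \<le> K" for i
  proof (cases "i = 1")
    case True
    have "?C 1 (Suc l) = Xi_sum N d A k (int l) * B"
      using B by (simp add: C_block_eq_Xi_sum)
    \<comment> \<open>The recurrence requires positive weight, which is where \<open>0 < l\<close>
      enters.\<close>
    also have "\<dots> = mat_sum d d (\<lambda>h. ?H h * Xi_sum N d A k (int l - int h)) {1..K} * B"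
      using l by (subst Xi_sum_recurrence[OF A k K]) auto
    also have "\<dots> = mat_sum d m (\<lambda>h. ?H h * Xi_sum N d A k (int l - int h) * B) {1..K}"
      using B by (intro mat_sum_mult_right mult_carrier_mat[OF H Xi_sum_carrier])
    also have "\<dots> = mat_sum d m (\<lambda>h. ?H h * ?C h l) {1..K}"
      using B by (intro mat_sum_cong refl)
        (simp add: C_block_eq_Xi_sum assoc_mult_mat[OF H Xi_sum_carrier])
    finally show ?thesis using True by simp
  next
    case False
    \<comment> \<open>Row \<open>i\<close> has its identity block in column \<open>i - 1\<close>,
      which lies in \<open>{1..K}\<close> because \<open>i\<close> is at least 2 here.\<close>
    have "mat_sum d m (\<lambda>h. ?F i h * ?C h l) {1..K} =
        mat_sum d m (\<lambda>h. if h = i - 1 then ?C h l else 0\<^sub>m d m) {1..K}"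
      using False i left_mult_one_mat[OF C] left_mult_zero_mat[OF C]
      by (intro mat_sum_cong) auto
    also have "\<dots> = ?C (i - 1) l"
      using False i C by (intro mat_sum_delta) auto
    also have "\<dots> = ?C i (Suc l)"
      using i by (simp add: C_block_def of_nat_diff algebra_simps)
    finally show ?thesis .
  qed
  then have "block_mat K 1 d m (\<lambda>i j. mat_sum d m (\<lambda>h. ?F i h * ?C h l) {1..K}) =
      block_mat K 1 d m (\<lambda>i _. ?C i (Suc l))"
    by (intro block_mat_cong)
  moreover have "A_hat N d A k K * block_mat K 1 d m (\<lambda>i _. ?C i l) =
      block_mat K 1 d m (\<lambda>i j. mat_sum d m (\<lambda>h. ?F i h * ?C h l) {1..K})"
    unfolding A_hat_def using C H by (intro block_mat_mult) auto
  ultimately show ?thesis by simp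
qed

text \<open>The weights in this column are \<open>1 - i\<close>: the first block is the identity
  times \<open>B\<close>, and all later weights are negative.\<close>

lemma C_column_1:
  assumes B: "B \<in> carrier_mat d m" and k: "\<And>i. i < N \<Longrightarrow> 0 < k i"
  shows "block_mat K 1 d m (\<lambda>i _. C_block N d m A B k i 1) = B_hat d m B K"
  unfolding B_hat_def
proof (rule block_mat_cong)
  fix i j :: nat assume "1 \<le> i"
  then show "C_block N d m A B k i 1 = (if i = 1 then B else 0\<^sub>m d m)"
    using B by (auto simp: C_block_eq_Xi_sum Xi_sum_0[OF k] Xi_sum_neg)
qed

text \<open>Matrix powers are defined by multiplying on the right, whereas the induction on columns
  needs the new factor on the left.\<close>

lemma pow_mat_Suc_left:
  assumes "A \<in> carrier_mat n n"
  shows "A ^\<^sub>m Suc l = A * A ^\<^sub>m l"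
proof (induction l)
  case (Suc l)
  have "A ^\<^sub>m Suc (Suc l) = (A * A ^\<^sub>m l) * A" using Suc by simp
  also have "\<dots> = A * (A ^\<^sub>m l * A)"
    using assms by (intro assoc_mult_mat[of _ n n _ n _ n] pow_carrier_mat) auto
  finally show ?case by simp
qed (use assms in auto)

text \<open>Induction on the exponent: \<open>B_hat\<close> is the first column, and each factor
  \<open>A_hat\<close> advances by one column. The exponent \<open>l\<close> meets column
  \<open>Suc l\<close> because blocks are numbered from 1.\<close>

lemma C_column_eq:
  assumes A: "\<And>i. i < N \<Longrightarrow> A i \<in> carrier_mat d d" and B: "B \<in> carrier_mat d m"
    and k: "\<And>i. i < N \<Longrightarrow> 0 < k i" and K: "\<And>i. i < N \<Longrightarrow> k i \<le> K"
  shows "A_hat N d A k K ^\<^sub>m l * B_hat d m B K =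
    block_mat K 1 d m (\<lambda>i _. C_block N d m A B k i (Suc l))"
proof (induction l)
  have Ah: "A_hat N d A k K \<in> carrier_mat (K * d) (K * d)"
    by (simp add: A_hat_def)
  have Bh: "B_hat d m B K \<in> carrier_mat (K * d) (1 * m)"
    unfolding B_hat_def by (rule block_mat_carrier)
  {
    case 0
    show ?case
      using Ah Bh C_column_1[where K = K and A = A, OF B k] by simp
  next
    case (Suc l)
    have "A_hat N d A k K ^\<^sub>m Suc l * B_hat d m B K =
        A_hat N d A k K * (A_hat N d A k K ^\<^sub>m l * B_hat d m B K)"
      unfolding pow_mat_Suc_left[OF Ah]
      using Ah Bh by (intro assoc_mult_mat[OF _ pow_carrier_mat])
    also have "\<dots> = block_mat K 1 d m (\<lambda>i _. C_block N d m A B k i (Suc (Suc l)))"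
      unfolding Suc by (intro A_hat_mult_C_column A B k K) auto
    finally show ?case .
  }
qed

theorem theorem3p12:
  fixes N d m K M :: nat
    and A :: "nat \<Rightarrow> complex mat" and B :: "complex mat"
    and T lam :: real and Lambda :: "nat \<Rightarrow> real" and k :: "nat \<Rightarrow> nat"
  assumes "0 < N" and "0 < d" and "0 < m"
    and "\<And>j. j < N \<Longrightarrow> A j \<in> carrier_mat d d"
    and "B \<in> carrier_mat d m"
    and "0 < T"
    and "0 < lam"
    and "\<And>j. j < N \<Longrightarrow> 0 < k j"
    and "\<And>j. j < N \<Longrightarrow> Lambda j = lam * real (k j)"
    and "K = Max (k ` {..<N})"
    and "M = nat \<lfloor>T / lam\<rfloor>"
  shows "C_mat N d m A B k K M =
    block_mat 1 M (K * d) m (\<lambda>_ l. (A_hat N d A k K ^\<^sub>m (l - 1)) * B_hat d m B K)"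
proof -
  have "k j \<le> K" if "j < N" for j
    using that assms(10) by simp
  note column = C_column_eq[OF assms(4,5,8) this]
  have "block_mat 1 M (K * d) m (\<lambda>_ l. (A_hat N d A k K ^\<^sub>m (l - 1)) * B_hat d m B K) =
      block_mat 1 M (K * d) m (\<lambda>_ l. block_mat K 1 d m (\<lambda>i _. C_block N d m A B k i l))"
    \<comment> \<open>Block numbers satisfy \<open>1 \<le> l\<close>, so the truncated
      \<open>l - 1\<close> is exact and \<open>Suc (l - 1) = l\<close>.\<close>
    by (rule block_mat_cong) (simp add: column)
  also have "\<dots> = C_mat N d m A B k K M"
    \<comment> \<open>Flattening of nested blocks: the single outer block row keeps the row index
      unchanged, and \<open>b mod m < m\<close> places the column in the only inner block
      column.\<close>
    unfolding C_mat_def using assms(3)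
    by (intro eq_matI) (auto simp: block_mat_def)
  finally show ?thesis by simp
qed

end
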